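(* Let $p$ be a prime and let $J(y),K(y)\in\mathbb{Z}_p[y]$ be vanishing polynomials over $\mathbb{Z}_p$. Then the polynomial $$G(y)=J(y)+x\cdot K(y)\in\left(\mathbb{Z}_p[x]/(x^2)\right)[y]$$ vanishes over $\mathbb{Z}_p[x]/(x^2)$ if and only if the formal derivative $J'(y)$ vanishes over $\mathbb{Z}_p$.
   Context: $\mathbb{Z}_p$ denotes the ring of integers modulo $p$. A polynomial $F(y)\in R[y]$ over a commutative ring $R$ with identity is called vanishing over $R$ if $F(r)=0$ for all $r\in R$ (the zero polynomial is vanishing). In $G$, the symbol $x$ denotes the class of $x$ in $\mathbb{Z}_p[x]/(x^2)$, $y$ is the polynomial indeterminate, and the coefficients of $J$ and $K$ are viewed in $\mathbb{Z}_p[x]/(x^2)$ via the natural inclusion of $\mathbb{Z}_p$. The formal derivative of $P(y)=a_ny^n+\cdots+a_1y+a_0$ is $P'(y)=na_ny^{n-1}+\cdots+2a_2y+a_1$. *)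

theory Defs
  imports "HOL-Algebra.UnivPoly" "HOL-Algebra.QuotRing" "HOL-Number_Theory.Residues"
begin

text \<open>Membership is part of the definition because \<^const>\<open>eval\<close> is unspecified outside the
  carrier of the polynomial ring.\<close>

definition vanishing :: "('a, 'm) ring_scheme \<Rightarrow> (nat \<Rightarrow> 'a) \<Rightarrow> bool"
  where "vanishing R F \<longleftrightarrow>
    F \<in> carrier (UP R) \<and> (\<forall>r \<in> carrier R. eval R R id r F = \<zero>\<^bsub>R\<^esub>)"

definition formal_deriv :: "('a, 'm) ring_scheme \<Rightarrow> (nat \<Rightarrow> 'a) \<Rightarrow> (nat \<Rightarrow> 'a)"
  where "formal_deriv R F =
    (\<Oplus>\<^bsub>UP R\<^esub> i \<in> {1..deg R F}. monom (UP R) ([i] \<cdot>\<^bsub>R\<^esub> coeff (UP R) F i) (i - 1))"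

definition map_coeffs ::
    "('a, 'm) ring_scheme \<Rightarrow> ('b, 'n) ring_scheme \<Rightarrow> ('a \<Rightarrow> 'b) \<Rightarrow> (nat \<Rightarrow> 'a) \<Rightarrow> (nat \<Rightarrow> 'b)"
  where "map_coeffs R S phi F =
    (\<Oplus>\<^bsub>UP S\<^esub> i \<in> {..deg R F}. monom (UP S) (phi (coeff (UP R) F i)) i)"

abbreviation Zmod :: "nat \<Rightarrow> int ring"
  where "Zmod p \<equiv> residue_ring (int p)"

text \<open>The quotient of the polynomial ring in \<open>x\<close> over \<^term>\<open>Zmod p\<close> by the principal ideal
  generated by \<open>x\<close> squared; its elements are cosets, and \<open>dual_x\<close> is the class of \<open>x\<close>. In
  \<open>dual_poly\<close> the indeterminate of the outer polynomial ring is \<open>y\<close>.\<close>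

definition sq_ideal :: "nat \<Rightarrow> (nat \<Rightarrow> int) set"
  where "sq_ideal p = PIdl\<^bsub>UP (Zmod p)\<^esub> (monom (UP (Zmod p)) \<one>\<^bsub>Zmod p\<^esub> 1 [^]\<^bsub>UP (Zmod p)\<^esub> (2::nat))"

definition dual_ring :: "nat \<Rightarrow> (nat \<Rightarrow> int) set ring"
  where "dual_ring p = UP (Zmod p) Quot sq_ideal p"

definition dual_x :: "nat \<Rightarrow> (nat \<Rightarrow> int) set"
  where "dual_x p = sq_ideal p +>\<^bsub>UP (Zmod p)\<^esub> monom (UP (Zmod p)) \<one>\<^bsub>Zmod p\<^esub> 1"

definition dual_const :: "nat \<Rightarrow> int \<Rightarrow> (nat \<Rightarrow> int) set"
  where "dual_const p a = sq_ideal p +>\<^bsub>UP (Zmod p)\<^esub> monom (UP (Zmod p)) a 0"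

definition dual_poly :: "nat \<Rightarrow> (nat \<Rightarrow> int) \<Rightarrow> (nat \<Rightarrow> (nat \<Rightarrow> int) set)"
  where "dual_poly p F = map_coeffs (Zmod p) (dual_ring p) (dual_const p) F"

lemma (in UP_cring) coeff_formal_deriv:
  assumes "F \<in> carrier P"
  shows "coeff P (formal_deriv R F) n = [Suc n] \<cdot> coeff P F (Suc n)"
proof -
  have c: "monom P ([i] \<cdot> coeff P F i) (i - 1) \<in> carrier P" for i :: nat
    using assms by simp
  have eq: "formal_deriv R F =
      (\<Oplus>\<^bsub>P\<^esub> i \<in> {1..deg R F}. monom P ([i] \<cdot> coeff P F i) (i - 1))"
    by (simp add: formal_deriv_def P_def)
  have "coeff P (formal_deriv R F) n =
      (\<Oplus> i \<in> {1..deg R F}. coeff P (monom P ([i] \<cdot> coeff P F i) (i - 1)) n)"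
    unfolding eq using c by (intro coeff_finsum) auto
  also have "\<dots> = (\<Oplus> i \<in> {1..deg R F}. if Suc n = i then [i] \<cdot> coeff P F i else \<zero>)"
    by (rule R.finsum_cong') (use assms in auto)
  also have "\<dots> = [Suc n] \<cdot> coeff P F (Suc n)"
  proof (cases "Suc n \<le> deg R F")
    case True
    then show ?thesis
      using R.finsum_singleton[of "Suc n" "{1..deg R F}" "\<lambda>i. [i] \<cdot> coeff P F i"] assms by auto
  next
    case False
    then have "coeff P F (Suc n) = \<zero>"
      using assms deg_aboveD by simp
    moreover have "(\<Oplus> i \<in> {1..deg R F}. if Suc n = i then [i] \<cdot> coeff P F i else \<zero>)
        = (\<Oplus> i \<in> {1..deg R F}. \<zero>)"
      by (rule R.finsum_cong') (use False in auto)
    ultimately show ?thesis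
      using R.add.nat_pow_one by simp
  qed
  finally show ?thesis .
qed

lemma ideal_sq_ideal:
  assumes "p > 1"
  shows "ideal (sq_ideal p) (UP (Zmod p))"
proof -
  interpret residues "int p" "Zmod p"
    using assms by unfold_locales auto
  interpret UP_cring "Zmod p" "UP (Zmod p)"
    by (rule UP_cring.intro) (rule cring)
  show ?thesis
    unfolding sq_ideal_def by (intro P.cgenideal_ideal) simp
qed

lemma cring_dual_ring:
  assumes "p > 1"
  shows "cring (dual_ring p)"
proof -
  interpret residues "int p" "Zmod p"
    using assms by unfold_locales auto
  interpret UP_cring "Zmod p" "UP (Zmod p)"
    by (rule UP_cring.intro) (rule cring)
  show ?thesis
    unfolding dual_ring_def
    by (rule ideal.quotient_is_cring[OF ideal_sq_ideal[OF assms] P.is_cring])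
qed

end

theory Submission
  imports Defs
begin

text \<open>
  Write \<open>R\<close> for the integers modulo \<open>p\<close>, \<open>S\<close> for \<open>R[x]/(x\<^sup>2)\<close> and \<open>e\<close> for the class of \<open>x\<close>. Since
  \<open>e\<^sup>2 = 0\<close>, the Taylor expansion of a polynomial \<open>F\<close> over \<open>R\<close> at a point \<open>a + e b\<close> of \<open>S\<close> stops
  after the linear term (\<open>eval_square_zero_taylor\<close>):
  \<open>F(a + e b) = F(a) + e b F'(a)\<close>.
  If \<open>J\<close> and \<open>K\<close> vanish on \<open>R\<close>, this gives \<open>J(a + e b) = e b J'(a)\<close> and
  \<open>e K(a + e b) = e\<^sup>2 b K'(a) = 0\<close>, so \<open>G(a + e b) = e b J'(a)\<close>.

  If \<open>J'\<close> vanishes on \<open>R\<close>, then so does \<open>G\<close> on \<open>S\<close>, because every element of \<open>S\<close> has the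
  form \<open>a + e b\<close> (\<open>dual_ring_elementE\<close>). Conversely, the choice \<open>b = 1\<close> yields \<open>e J'(a) = 0\<close>, and
  this forces \<open>J'(a) = 0\<close>, because a multiple of \<open>x\<^sup>2\<close> has no linear term
  (\<open>dual_x_mult_const_eq_zero\<close>).

  The Taylor formula holds for any homomorphism \<open>R \<rightarrow> S\<close> of commutative rings and any \<open>e\<close> in \<open>S\<close>
  with \<open>e\<^sup>2 = 0\<close>. It is additive in \<open>F\<close>, so that only monomials have to be checked.
\<close>

section \<open>Formal derivatives and evaluation\<close>

context UP_cring
begin

lemma formal_deriv_closed:
  assumes "F \<in> carrier P"
  shows "formal_deriv R F \<in> carrier P"
  unfolding formal_deriv_def P_def[symmetric] using assms by (intro P.finsum_closed) auto

text \<open>Identities that are additive in the polynomial reduce to monomials, so neither the degree of a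
  sum nor a reindexing of coefficient sums has to be considered.\<close>

lemma monom_sum_induct [consumes 1, case_names monom add]:
  assumes F: "F \<in> carrier P"
    and monom: "\<And>c n. c \<in> carrier R \<Longrightarrow> Q (monom P c n)"
    and add: "\<And>f g. f \<in> carrier P \<Longrightarrow> g \<in> carrier P \<Longrightarrow> Q f \<Longrightarrow> Q g \<Longrightarrow> Q (f \<oplus>\<^bsub>P\<^esub> g)"
  shows "Q F"
proof -
  have "Q (\<Oplus>\<^bsub>P\<^esub> i \<in> {..n}. monom P (coeff P F i) i)" for n
  proof (induction n)
    case 0
    show ?case using F monom by simp
  next
    case (Suc n)
    have "(\<Oplus>\<^bsub>P\<^esub> i \<in> {..n}. monom P (coeff P F i) i) \<in> carrier P"
      using F by (intro P.finsum_closed) auto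
    then show ?case using F monom add Suc by (simp add: Pi_def)
  qed
  then show ?thesis using up_repr[OF F] by metis
qed

text \<open>The formula covers constants: for \<open>n = 0\<close> the multiple \<open>[0] \<cdot> c\<close> is zero, whatever the truncated
  exponent.\<close>

lemma formal_deriv_monom:
  assumes "c \<in> carrier R"
  shows "formal_deriv R (monom P c n) = monom P ([n] \<cdot> c) (n - 1)"
  by (rule up_eqI; cases n)
    (use assms in \<open>auto simp: coeff_formal_deriv formal_deriv_closed
      simp del: R.add.nat_pow_Suc\<close>)

lemma formal_deriv_add:
  assumes "F \<in> carrier P" "G \<in> carrier P"
  shows "formal_deriv R (F \<oplus>\<^bsub>P\<^esub> G) = formal_deriv R F \<oplus>\<^bsub>P\<^esub> formal_deriv R G"
  by (rule up_eqI)
    (use assms in \<open>simp_all add: coeff_formal_deriv formal_deriv_closed R.add.nat_pow_distrib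
      del: R.add.nat_pow_Suc\<close>)

lemma eval_id_univ_prop: "UP_pre_univ_prop R R id"
  by unfold_locales (simp add: ring_hom_def)

lemma eval_id_ring_hom_cring:
  assumes "a \<in> carrier R"
  shows "ring_hom_cring P R (eval R R id a)"
  by unfold_locales
    (rule UP_pre_univ_prop.eval_ring_hom[OF eval_id_univ_prop assms, folded P_def])

lemma eval_id_monom:
  assumes "a \<in> carrier R" "c \<in> carrier R"
  shows "eval R R id a (monom P c n) = c \<otimes> a [^] n"
  using UP_pre_univ_prop.eval_monom[OF eval_id_univ_prop assms(2,1), folded P_def] by simp

end

section \<open>Taylor expansion along an element of square zero\<close>

text \<open>All further terms of the binomial expansion contain \<open>d\<^sup>2\<close>.\<close>

lemma (in cring) pow_add_square_zero:
  assumes a: "a \<in> carrier R" and d: "d \<in> carrier R" and d2: "d \<otimes> d = \<zero>"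
  shows "(a \<oplus> d) [^] (n::nat) = a [^] n \<oplus> [n] \<cdot> (a [^] (n - 1) \<otimes> d)"
proof (induction n)
  case 0
  show ?case by simp
next
  case (Suc n)
  have k: "[n] \<cdot> (a [^] (n - 1) \<otimes> d) \<otimes> d = \<zero>"
    using a d by (simp add: add_pow_ldistr m_assoc d2)
  have m: "[n] \<cdot> (a [^] (n - 1) \<otimes> d) \<otimes> a = [n] \<cdot> (a [^] n \<otimes> d)"
  proof (cases n)
    case (Suc m)
    have "(a [^] m \<otimes> d) \<otimes> a = a [^] Suc m \<otimes> d" using a d by (simp add: m_ac)
    then show ?thesis using a d Suc by (simp add: add_pow_ldistr del: add.nat_pow_Suc)
  qed (use a in simp)
  have "(a \<oplus> d) [^] Suc n = (a [^] n \<oplus> [n] \<cdot> (a [^] (n - 1) \<otimes> d)) \<otimes> (a \<oplus> d)"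
    using Suc by simp
  also have "\<dots> = (a [^] n \<otimes> a \<oplus> [n] \<cdot> (a [^] (n - 1) \<otimes> d) \<otimes> a)
      \<oplus> (a [^] n \<otimes> d \<oplus> [n] \<cdot> (a [^] (n - 1) \<otimes> d) \<otimes> d)"
    using a d by (simp add: l_distr r_distr)
  also have "\<dots> = a [^] Suc n \<oplus> [Suc n] \<cdot> (a [^] n \<otimes> d)"
    unfolding k m using a d by (simp add: a_ac)
  finally show ?case by simp
qed

context UP_pre_univ_prop
begin

text \<open>Evaluating the image polynomial over \<open>S\<close> is the evaluation that the universal property of
  \<open>R[y]\<close> provides. This avoids computing the degree of the image, which may drop.\<close>

lemma eval_map_coeffs:
  assumes F: "F \<in> carrier P" and s: "s \<in> carrier S"
  shows "map_coeffs R S h F \<in> carrier (UP S)"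
    and "eval S S id s (map_coeffs R S h F) = eval R S h s F"
proof -
  interpret T: UP_cring S "UP S"
    by (rule UP_cring.intro) (rule S.is_cring)
  interpret E: ring_hom_cring "UP S" S "eval S S id s"
    using T.eval_id_ring_hom_cring[OF s] .
  have eq: "map_coeffs R S h F = (\<Oplus>\<^bsub>UP S\<^esub> i \<in> {..deg R F}. monom (UP S) (h (coeff P F i)) i)"
    by (simp add: map_coeffs_def P_def)
  show "map_coeffs R S h F \<in> carrier (UP S)"
    unfolding eq using F by (intro T.P.finsum_closed) auto
  show "eval S S id s (map_coeffs R S h F) = eval R S h s F"
    unfolding eq eval_on_carrier[OF F] using F s
    by (subst E.hom_finsum)
      (auto simp: Pi_def T.eval_id_monom intro!: S.finsum_cong')
qed

text \<open>For a monomial this is the truncated binomial expansion. The choice \<open>a = 0\<close>, \<open>b = 1\<close> is of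
  interest too: it evaluates \<open>F\<close> at \<open>e\<close> itself and shows that only the two lowest terms
  survive.\<close>

lemma eval_square_zero_taylor:
  assumes F: "F \<in> carrier P" and a: "a \<in> carrier R" and b: "b \<in> carrier R"
    and e: "e \<in> carrier S" and e2: "e \<otimes>\<^bsub>S\<^esub> e = \<zero>\<^bsub>S\<^esub>"
  shows "eval R S h (h a \<oplus>\<^bsub>S\<^esub> e \<otimes>\<^bsub>S\<^esub> h b) F
    = h (eval R R id a F) \<oplus>\<^bsub>S\<^esub> e \<otimes>\<^bsub>S\<^esub> h (b \<otimes> eval R R id a (formal_deriv R F))"
proof -
  let ?d = "e \<otimes>\<^bsub>S\<^esub> h b" and ?s = "h a \<oplus>\<^bsub>S\<^esub> e \<otimes>\<^bsub>S\<^esub> h b"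
  have s: "?s \<in> carrier S" using a b e by simp
  have d2: "?d \<otimes>\<^bsub>S\<^esub> ?d = \<zero>\<^bsub>S\<^esub>"
  proof -
    have "?d \<otimes>\<^bsub>S\<^esub> ?d = (e \<otimes>\<^bsub>S\<^esub> e) \<otimes>\<^bsub>S\<^esub> (h b \<otimes>\<^bsub>S\<^esub> h b)" using b e by (simp add: S.m_ac)
    then show ?thesis using b e2 by simp
  qed
  interpret E: ring_hom_cring P S "eval R S h ?s"
    by unfold_locales (rule eval_ring_hom[OF s])
  interpret E0: ring_hom_cring P R "eval R R id a"
    using eval_id_ring_hom_cring[OF a] .
  show ?thesis
    using F
  proof (induction rule: monom_sum_induct)
    case (monom c n)
    have hn: "h ([k] \<cdot> x) = [k] \<cdot>\<^bsub>S\<^esub> h x" if "x \<in> carrier R" for x and k :: nat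
      using that by (induction k) auto
    have "h c \<otimes>\<^bsub>S\<^esub> ([n] \<cdot>\<^bsub>S\<^esub> (h a [^]\<^bsub>S\<^esub> (n - 1) \<otimes>\<^bsub>S\<^esub> ?d))
        = [n] \<cdot>\<^bsub>S\<^esub> (e \<otimes>\<^bsub>S\<^esub> (h b \<otimes>\<^bsub>S\<^esub> (h c \<otimes>\<^bsub>S\<^esub> h a [^]\<^bsub>S\<^esub> (n - 1))))"
      using a b e monom by (simp add: S.add_pow_rdistr S.m_ac)
    also have "\<dots> = e \<otimes>\<^bsub>S\<^esub> (h b \<otimes>\<^bsub>S\<^esub> (([n] \<cdot>\<^bsub>S\<^esub> h c) \<otimes>\<^bsub>S\<^esub> h a [^]\<^bsub>S\<^esub> (n - 1)))"
      using a b e monom by (simp add: S.add_pow_rdistr S.add_pow_ldistr)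
    finally have lin: "h c \<otimes>\<^bsub>S\<^esub> ([n] \<cdot>\<^bsub>S\<^esub> (h a [^]\<^bsub>S\<^esub> (n - 1) \<otimes>\<^bsub>S\<^esub> ?d))
        = e \<otimes>\<^bsub>S\<^esub> h (b \<otimes> ([n] \<cdot> c \<otimes> a [^] (n - 1)))"
      using a b monom by (simp add: hn)
    have E0_monom: "eval R R id a (monom P c n) = c \<otimes> a [^] n"
      "eval R R id a (formal_deriv R (monom P c n)) = [n] \<cdot> c \<otimes> a [^] (n - 1)"
      using a monom by (simp_all only: formal_deriv_monom eval_id_monom R.add.nat_pow_closed)
    show ?case
      unfolding E0_monom lin[symmetric] eval_monom[OF monom s]
      using a b e monom d2 by (simp add: S.pow_add_square_zero S.r_distr)
  next
    case (add f g)
    define ev where "ev = eval R R id a"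
    have ev: "\<And>u. u \<in> carrier P \<Longrightarrow> ev u \<in> carrier R"
      "\<And>u v. u \<in> carrier P \<Longrightarrow> v \<in> carrier P \<Longrightarrow> ev (u \<oplus>\<^bsub>P\<^esub> v) = ev u \<oplus> ev v"
      by (simp_all only: ev_def E0.hom_closed E0.hom_add)
    show ?case
      using add a b e unfolding ev_def[symmetric]
      by (simp add: ev formal_deriv_add formal_deriv_closed R.r_distr S.r_distr S.a_ac)
  qed
qed

end

section \<open>The dual numbers as a quotient of the polynomial ring\<close>

lemma (in UP_cring) linear_monom_in_square_ideal:
  assumes c: "c \<in> carrier R"
    and mem: "monom P c 1 \<in> PIdl\<^bsub>P\<^esub> (monom P \<one> 1 [^]\<^bsub>P\<^esub> (2::nat))"
  shows "c = \<zero>"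
proof -
  obtain q where q: "q \<in> carrier P" "monom P c 1 = q \<otimes>\<^bsub>P\<^esub> monom P \<one> 2"
    using mem by (auto simp: cgenideal_def monom_pow)
  have "coeff P (q \<otimes>\<^bsub>P\<^esub> monom P \<one> 2) 1 = \<zero>"
    using q(1) by (simp add: Pi_def)
  then show ?thesis
    using q c by (metis coeff_monom)
qed

lemma UP_cring_Zmod: "p > 1 \<Longrightarrow> UP_cring (Zmod p)"
  by (intro UP_cring.intro residues.cring residues.intro) auto

lemma rcos_ring_hom_cring_dual:
  assumes "p > 1"
  shows "ring_hom_cring (UP (Zmod p)) (dual_ring p) ((+>\<^bsub>UP (Zmod p)\<^esub>) (sq_ideal p))"
  unfolding dual_ring_def
  by (rule ideal.rcos_ring_hom_cring[OF ideal_sq_ideal[OF assms]])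
    (rule UP_cring.UP_cring[OF UP_cring_Zmod[OF assms]])

lemma UP_pre_univ_prop_dual_const:
  assumes "p > 1"
  shows "UP_pre_univ_prop (Zmod p) (dual_ring p) (dual_const p)"
proof -
  interpret UP_cring "Zmod p" "UP (Zmod p)"
    using UP_cring_Zmod[OF assms] .
  interpret q: ring_hom_cring "UP (Zmod p)" "dual_ring p" "(+>\<^bsub>UP (Zmod p)\<^esub>) (sq_ideal p)"
    using rcos_ring_hom_cring_dual[OF assms] .
  show ?thesis
    using ring_hom_trans[OF const_ring_hom q.homh]
    by unfold_locales (simp add: comp_def dual_const_def[abs_def])
qed

lemma dual_x_closed:
  assumes "p > 1"
  shows "dual_x p \<in> carrier (dual_ring p)"
proof -
  interpret UP_cring "Zmod p" "UP (Zmod p)"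
    using UP_cring_Zmod[OF assms] .
  interpret q: ring_hom_cring "UP (Zmod p)" "dual_ring p" "(+>\<^bsub>UP (Zmod p)\<^esub>) (sq_ideal p)"
    using rcos_ring_hom_cring_dual[OF assms] .
  show ?thesis unfolding dual_x_def by simp
qed

lemma dual_class_eq_zero_iff:
  assumes p: "p > 1" and f: "f \<in> carrier (UP (Zmod p))"
  shows "sq_ideal p +>\<^bsub>UP (Zmod p)\<^esub> f = \<zero>\<^bsub>dual_ring p\<^esub> \<longleftrightarrow> f \<in> sq_ideal p"
proof -
  interpret I: ideal "sq_ideal p" "UP (Zmod p)" using ideal_sq_ideal[OF p] .
  show ?thesis
    unfolding dual_ring_def FactRing_def
    using f I.a_rcos_const I.rcos_const_imp_mem by (auto intro: I.a_rcos_self)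
qed

lemma dual_x_square:
  assumes p: "p > 1"
  shows "dual_x p \<otimes>\<^bsub>dual_ring p\<^esub> dual_x p = \<zero>\<^bsub>dual_ring p\<^esub>"
proof -
  interpret UP_cring "Zmod p" "UP (Zmod p)"
    using UP_cring_Zmod[OF assms] .
  interpret q: ring_hom_cring "UP (Zmod p)" "dual_ring p" "(+>\<^bsub>UP (Zmod p)\<^esub>) (sq_ideal p)"
    using rcos_ring_hom_cring_dual[OF assms] .
  let ?X = "monom (UP (Zmod p)) \<one>\<^bsub>Zmod p\<^esub> 1"
  have "?X \<otimes>\<^bsub>UP (Zmod p)\<^esub> ?X \<in> sq_ideal p"
    unfolding sq_ideal_def
    using P.cgenideal_self[of "?X [^]\<^bsub>UP (Zmod p)\<^esub> (2::nat)"] 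
    by (simp add: monom_pow numeral_2_eq_2)
  then show ?thesis
    unfolding dual_x_def
    by (subst q.hom_mult[symmetric]) (simp_all only: dual_class_eq_zero_iff[OF p] monom_closed
        R.one_closed P.m_closed)
qed

text \<open>The product is the class of the monomial \<open>c x\<close>, which lies in the ideal of \<open>x\<^sup>2\<close> only for
  \<open>c = 0\<close>.\<close>

lemma dual_x_mult_const_eq_zero:
  assumes p: "p > 1" and c: "c \<in> carrier (Zmod p)"
    and z: "dual_x p \<otimes>\<^bsub>dual_ring p\<^esub> dual_const p c = \<zero>\<^bsub>dual_ring p\<^esub>"
  shows "c = \<zero>\<^bsub>Zmod p\<^esub>"
proof -
  interpret UP_cring "Zmod p" "UP (Zmod p)"
    using UP_cring_Zmod[OF p] .
  interpret q: ring_hom_cring "UP (Zmod p)" "dual_ring p" "(+>\<^bsub>UP (Zmod p)\<^esub>) (sq_ideal p)"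
    using rcos_ring_hom_cring_dual[OF p] .
  let ?X = "monom (UP (Zmod p)) \<one>\<^bsub>Zmod p\<^esub> 1" and ?c = "monom (UP (Zmod p)) c 0"
  have "sq_ideal p +>\<^bsub>UP (Zmod p)\<^esub> (?X \<otimes>\<^bsub>UP (Zmod p)\<^esub> ?c) = \<zero>\<^bsub>dual_ring p\<^esub>"
    using z c unfolding dual_x_def dual_const_def by (subst q.hom_mult) auto
  then have "?X \<otimes>\<^bsub>UP (Zmod p)\<^esub> ?c \<in> sq_ideal p"
    using c by (simp only: dual_class_eq_zero_iff[OF p] monom_closed R.one_closed P.m_closed)
  moreover have "?X \<otimes>\<^bsub>UP (Zmod p)\<^esub> ?c = monom (UP (Zmod p)) c 1"
    using monom_mult[of "\<one>\<^bsub>Zmod p\<^esub>" c 1 0] c by simp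
  ultimately have "monom (UP (Zmod p)) c 1 \<in> sq_ideal p"
    by simp
  then show ?thesis
    using linear_monom_in_square_ideal[OF c] by (simp add: sq_ideal_def)
qed

text \<open>The quotient map and the evaluation at the class of \<open>x\<close> agree on
  constants and on \<open>x\<close>, so by uniqueness the class of \<open>f\<close> is \<open>f\<close> evaluated at \<open>0 + e 1\<close>, and
  the Taylor formula writes it as \<open>f(0) + e f'(0)\<close>.\<close>

lemma dual_ring_elementE:
  assumes p: "p > 1" and s: "s \<in> carrier (dual_ring p)"
  obtains a b where "a \<in> carrier (Zmod p)" "b \<in> carrier (Zmod p)"
    "s = dual_const p a \<oplus>\<^bsub>dual_ring p\<^esub> dual_x p \<otimes>\<^bsub>dual_ring p\<^esub> dual_const p b"
proof -
  interpret U: UP_pre_univ_prop "Zmod p" "dual_ring p" "dual_const p" "UP (Zmod p)"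
    by (rule UP_pre_univ_prop_dual_const[OF p])
  note e = dual_x_closed[OF p] dual_x_square[OF p]
  obtain f where f: "f \<in> carrier (UP (Zmod p))" and sf: "s = sq_ideal p +>\<^bsub>UP (Zmod p)\<^esub> f"
    using s unfolding dual_ring_def FactRing_def A_RCOSETS_def' by auto
  let ?ev = "eval (Zmod p) (Zmod p) id \<zero>\<^bsub>Zmod p\<^esub>"
  interpret E0: ring_hom_cring "UP (Zmod p)" "Zmod p" ?ev
    using U.eval_id_ring_hom_cring[OF U.R.zero_closed] .
  have "s = eval (Zmod p) (dual_ring p) (dual_const p) (dual_x p) f"
    unfolding sf
    by (rule U.UP_hom_unique[where s = "dual_x p"])
      (use f U.eval_monom1[OF e(1)] in \<open>simp_all add: e U.eval_const rcos_ring_hom_cring_dual[OF p]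
        U.ring_homD U.eval_ring_hom dual_x_def[unfolded One_nat_def, symmetric] dual_const_def[symmetric]\<close>)
  also have "\<dots> = eval (Zmod p) (dual_ring p) (dual_const p) (dual_const p \<zero>\<^bsub>Zmod p\<^esub>
      \<oplus>\<^bsub>dual_ring p\<^esub> dual_x p \<otimes>\<^bsub>dual_ring p\<^esub> dual_const p \<one>\<^bsub>Zmod p\<^esub>) f"
    using e by simp
  also have "\<dots> = dual_const p (?ev f) \<oplus>\<^bsub>dual_ring p\<^esub>
      dual_x p \<otimes>\<^bsub>dual_ring p\<^esub> dual_const p (\<one>\<^bsub>Zmod p\<^esub> \<otimes>\<^bsub>Zmod p\<^esub> ?ev (formal_deriv (Zmod p) f))"
    by (rule U.eval_square_zero_taylor[OF f U.R.zero_closed U.R.one_closed e])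
  finally show ?thesis
    by (rule that[OF E0.hom_closed[OF f]
          U.R.m_closed[OF U.R.one_closed E0.hom_closed[OF U.formal_deriv_closed[OF f]]]])
qed

section \<open>Vanishing over the dual numbers\<close>

theorem proposition2:
  fixes p :: nat and J K :: "nat \<Rightarrow> int"
  assumes "prime p"
    and "J \<in> carrier (UP (Zmod p))" and "K \<in> carrier (UP (Zmod p))"
    and "vanishing (Zmod p) J" and "vanishing (Zmod p) K"
  shows "vanishing (dual_ring p)
           (dual_poly p J \<oplus>\<^bsub>UP (dual_ring p)\<^esub> dual_x p \<odot>\<^bsub>UP (dual_ring p)\<^esub> dual_poly p K)
         \<longleftrightarrow> vanishing (Zmod p) (formal_deriv (Zmod p) J)"
proof -
  let ?R = "Zmod p" and ?S = "dual_ring p" and ?h = "dual_const p" and ?e = "dual_x p"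
  let ?G = "dual_poly p J \<oplus>\<^bsub>UP ?S\<^esub> ?e \<odot>\<^bsub>UP ?S\<^esub> dual_poly p K"
  have p: "p > 1" using \<open>prime p\<close> by (rule prime_gt_1_nat)
  interpret U: UP_pre_univ_prop ?R ?S ?h "UP ?R"
    by (rule UP_pre_univ_prop_dual_const[OF p])
  interpret T: UP_cring ?S "UP ?S"
    by (rule UP_cring.intro) (rule U.S.is_cring)
  note J = \<open>J \<in> carrier (UP ?R)\<close> and K = \<open>K \<in> carrier (UP ?R)\<close>
  note e = dual_x_closed[OF p] dual_x_square[OF p]
  have G: "?G \<in> carrier (UP ?S)"
    using e U.eval_map_coeffs(1)[OF J U.S.zero_closed] U.eval_map_coeffs(1)[OF K U.S.zero_closed]
    by (simp add: dual_poly_def)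
  have val: "eval ?S ?S id (?h a \<oplus>\<^bsub>?S\<^esub> ?e \<otimes>\<^bsub>?S\<^esub> ?h b) ?G
      = ?e \<otimes>\<^bsub>?S\<^esub> ?h (b \<otimes>\<^bsub>?R\<^esub> eval ?R ?R id a (formal_deriv ?R J))"
    if a: "a \<in> carrier ?R" and b: "b \<in> carrier ?R" for a b
  proof -
    let ?s = "?h a \<oplus>\<^bsub>?S\<^esub> ?e \<otimes>\<^bsub>?S\<^esub> ?h b"
    let ?D = "\<lambda>F. b \<otimes>\<^bsub>?R\<^esub> eval ?R ?R id a (formal_deriv ?R F)"
    have s: "?s \<in> carrier ?S" using a b e by simp
    interpret E: UP_univ_prop ?S ?S id "UP ?S" ?s "eval ?S ?S id ?s"
      by unfold_locales (use s in \<open>auto simp: ring_hom_def\<close>)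
    interpret E0: ring_hom_cring "UP ?R" ?R "eval ?R ?R id a"
      using U.eval_id_ring_hom_cring[OF a] .
    have D: "?D F \<in> carrier ?R" if "F \<in> carrier (UP ?R)" for F
      using b that U.formal_deriv_closed by simp
    (* the constant Taylor term drops out for a vanishing polynomial *)
    have taylor: "eval ?S ?S id ?s (dual_poly p F) = ?e \<otimes>\<^bsub>?S\<^esub> ?h (?D F)"
      if "vanishing ?R F" for F
    proof -
      have F: "F \<in> carrier (UP ?R)" and v: "eval ?R ?R id a F = \<zero>\<^bsub>?R\<^esub>"
        using that a by (auto simp: vanishing_def)
      show ?thesis
        unfolding dual_poly_def U.eval_map_coeffs(2)[OF F s]
          U.eval_square_zero_taylor[OF F a b e] v
        using e D[OF F] by simp
    qed
    have "eval ?S ?S id ?s ?G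
        = eval ?S ?S id ?s (dual_poly p J) \<oplus>\<^bsub>?S\<^esub> ?e \<otimes>\<^bsub>?S\<^esub> eval ?S ?S id ?s (dual_poly p K)"
      using e U.eval_map_coeffs(1)[OF J s] U.eval_map_coeffs(1)[OF K s]
      by (simp add: dual_poly_def E.Eval_smult)
    also have "\<dots> = ?e \<otimes>\<^bsub>?S\<^esub> ?h (?D J) \<oplus>\<^bsub>?S\<^esub> (?e \<otimes>\<^bsub>?S\<^esub> ?e) \<otimes>\<^bsub>?S\<^esub> ?h (?D K)"
      using taylor assms(4,5) e D[OF K] by (simp add: U.S.m_assoc[symmetric])
    finally show ?thesis using e D J K by simp
  qed
  have D: "formal_deriv ?R J \<in> carrier (UP ?R)" using U.formal_deriv_closed[OF J] .
  show ?thesis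
  proof
    assume V: "vanishing ?S ?G"
    have "eval ?R ?R id a (formal_deriv ?R J) = \<zero>\<^bsub>?R\<^esub>" if a: "a \<in> carrier ?R" for a
    proof -
      interpret E0: ring_hom_cring "UP ?R" ?R "eval ?R ?R id a"
        using U.eval_id_ring_hom_cring[OF a] .
      have c: "eval ?R ?R id a (formal_deriv ?R J) \<in> carrier ?R" using D by simp
      have "?h a \<oplus>\<^bsub>?S\<^esub> ?e \<otimes>\<^bsub>?S\<^esub> ?h \<one>\<^bsub>?R\<^esub> \<in> carrier ?S"
        using a e by simp
      then have "?e \<otimes>\<^bsub>?S\<^esub> ?h (eval ?R ?R id a (formal_deriv ?R J)) = \<zero>\<^bsub>?S\<^esub>"
        using V val[OF a U.R.one_closed] c unfolding vanishing_def by simp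
      then show ?thesis using dual_x_mult_const_eq_zero[OF p c] by simp
    qed
    then show "vanishing ?R (formal_deriv ?R J)"
      using D by (simp add: vanishing_def)
  next
    assume V: "vanishing ?R (formal_deriv ?R J)"
    have "eval ?S ?S id s ?G = \<zero>\<^bsub>?S\<^esub>" if "s \<in> carrier ?S" for s
    proof -
      obtain a b where "a \<in> carrier ?R" "b \<in> carrier ?R"
        and "s = ?h a \<oplus>\<^bsub>?S\<^esub> ?e \<otimes>\<^bsub>?S\<^esub> ?h b"
        using dual_ring_elementE[OF p \<open>s \<in> carrier ?S\<close>] .
      then show ?thesis using val V e by (simp add: vanishing_def)
    qed
    then show "vanishing ?S ?G" using G by (simp add: vanishing_def)
  qed
qed

end
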